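(* Let $p$ be a prime and let $d$ be a positive integer properly dividing $p-1$ (that is, $d \mid p-1$ and $d \neq p-1$). Suppose $A, B \subseteq \mathbb{F}_p$ satisfy $A + B \subseteq Z_d \cup \{0\}$, where $Z_d = \{z \in \mathbb{F}_p : z^d = 1\}$. Then \[ |A|\,|B| \leq d + |B \cap (-A)|. \]
   Context: $\mathbb{F}_p$ is the field with $p$ elements. For $A,B\subseteq \mathbb{F}_p$, $A+B=\{a+b : a\in A,\ b\in B\}$ and $-A=\{-a : a\in A\}$. *)

theory Defs
  imports "HOL-Library.Set_Algebras" "HOL-Library.Cardinality"
    "HOL-Computational_Algebra.Computational_Algebra"
begin

text \<open>
  The field with \<open>p\<close> elements is modelled by an arbitrary type \<open>'a\<close> of class \<open>field\<close> and \<open>finite\<close>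
  with \<open>CARD('a) = p\<close>. The sumset \<open>A + B\<close> is the one of Set-Algebras; the negated set is written as
  the image \<open>uminus ` A\<close>, since \<open>- A\<close> denotes the complement in HOL.
\<close>

definition Z :: "nat \<Rightarrow> 'a::field set" where
  "Z d = {z. z ^ d = 1}"

end

theory Submission
  imports Defs
begin

text \<open>
  Stepanov's method. Let \<open>n = card A\<close>, and let \<open>w\<^sub>a\<close> be the Lagrange weights of the nodes \<open>A\<close>, so that
  \<open>\<Sum>a\<in>A. w\<^sub>a q(a)\<close> is the coefficient of \<open>x ^ (n - 1)\<close> in \<open>q\<close> whenever \<open>degree q < n\<close>. In
  \<open>f(x) = (\<Sum>a\<in>A. w\<^sub>a (x + a) ^ (n - 1 + d)) - 1\<close> all terms above \<open>x ^ d\<close> cancel, while the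
  coefficient of \<open>x ^ d\<close> is \<open>(n - 1 + d) choose d\<close>, which is nonzero because \<open>n - 1 + d \<le> 2 * d < p\<close>.
  At \<open>b \<in> B\<close> the factors \<open>(b + a) ^ d\<close> may be dropped from the Taylor coefficients of \<open>f\<close>, which
  hence vanish up to order \<open>n\<close>, or up to order \<open>n - 1\<close> if some \<open>b + a\<close> is zero. Counting the roots
  of \<open>f\<close> with multiplicity gives the bound.
\<close>

section \<open>Lagrange weights and their power moments\<close>

definition lagrange_weight :: "'a::field set \<Rightarrow> 'a \<Rightarrow> 'a" where
  "lagrange_weight A a = inverse (\<Prod>b\<in>A - {a}. a - b)"

text \<open>Lagrange interpolation is exact for \<open>q\<close> on the nodes \<open>A\<close>,
  because \<open>degree q < card A\<close>. Each basis polynomial \<open>P a\<close> is monic of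
  degree \<open>card A - 1\<close>, so comparing top coefficients gives the formula.\<close>

lemma sum_lagrange_weight:
  fixes A :: "'a::field set"
  assumes "finite A" and "degree q < card A"
  shows "(\<Sum>a\<in>A. lagrange_weight A a * poly q a) = coeff q (card A - 1)"
proof -
  define P where "P a = (\<Prod>b\<in>A - {a}. [:- b, 1:])" for a
  have deg_P: "degree (P a) = card A - 1" if "a \<in> A" for a
    using that assms(1) by (simp add: P_def degree_prod_sum_eq)
  have coeff_P: "coeff (P a) (card A - 1) = 1" if "a \<in> A" for a
    using lead_coeff_prod[of "\<lambda>b. [:- b, 1:]" "A - {a}"] deg_P[OF that] by (simp add: P_def)
  have poly_P: "poly (P a) x = (if x = a then \<Prod>b\<in>A - {a}. a - b else 0)" if "x \<in> A" for a x
    using that assms(1) by (auto simp: P_def poly_prod)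
  define r where "r = (\<Sum>a\<in>A. smult (lagrange_weight A a * poly q a) (P a))"
  have "q = r"
  proof (rule poly_eqI_degree[of A])
    fix x assume x: "x \<in> A"
    have "poly r x = (\<Sum>a\<in>A. if x = a then lagrange_weight A a * poly q a * (\<Prod>b\<in>A - {a}. a - b) else 0)"
      unfolding r_def poly_sum using x by (intro sum.cong) (auto simp: poly_P)
    also have "\<dots> = lagrange_weight A x * (\<Prod>b\<in>A - {x}. x - b) * poly q x"
      using x assms(1) by simp
    also have "\<dots> = poly q x"
      using assms(1) by (simp add: lagrange_weight_def)
    finally show "poly q x = poly r x" ..
  next
    have "degree r \<le> card A - 1"
      unfolding r_def by (intro degree_sum_le assms(1)) (metis deg_P degree_smult_le)
    then show "card A > degree r"
      using assms(2) by linarith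
  qed (use assms in simp)
  then have "coeff q (card A - 1) = coeff r (card A - 1)"
    by simp
  also have "\<dots> = (\<Sum>a\<in>A. lagrange_weight A a * poly q a)"
    by (auto simp: r_def coeff_sum coeff_P[simplified] intro!: sum.cong)
  finally show ?thesis ..
qed

lemma sum_lagrange_weight_power:
  fixes A :: "'a::field set"
  assumes "finite A" and "e < card A"
  shows "(\<Sum>a\<in>A. lagrange_weight A a * (a + b) ^ e) = of_bool (e = card A - 1)"
proof -
  have deg: "degree ([:b, 1:] ^ e) = e"
    by (simp add: degree_power_eq)
  have "(\<Sum>a\<in>A. lagrange_weight A a * (a + b) ^ e) = coeff ([:b, 1:] ^ e) (card A - 1)"
    using sum_lagrange_weight[of A "[:b, 1:] ^ e"] assms deg by (simp add: add.commute)
  also have "\<dots> = of_bool (e = card A - 1)"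
  proof (cases "e = card A - 1")
    case True
    then show ?thesis by (simp add: coeff_linear_poly_power)
  next
    case False
    then have "degree ([:b, 1:] ^ e) < card A - 1" using assms(2) deg by linarith
    then show ?thesis using False by (simp add: coeff_eq_0)
  qed
  finally show ?thesis .
qed

section \<open>Multiplicities of roots\<close>

lemma pcompose_power:
  fixes q r :: "'a::comm_semiring_1 poly"
  shows "pcompose (q ^ m) r = pcompose q r ^ m"
  by (induction m) (simp_all add: pcompose_mult pcompose_1)

text \<open>The coefficients of \<open>f(x + b)\<close> are the Taylor coefficients of
  \<open>f\<close> at \<open>b\<close>. Using them in place of derivatives avoids dividing by
  \<open>k!\<close>, which may vanish in positive characteristic.\<close>

lemma linear_power_dvdI:
  fixes f :: "'a::field poly"
  assumes "\<And>k. k < m \<Longrightarrow> coeff (pcompose f [:b, 1:]) k = 0"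
  shows "[:- b, 1:] ^ m dvd f"
proof -
  have "monom 1 m dvd pcompose f [:b, 1:]"
    using assms by (simp add: monom_1_dvd_iff')
  then obtain g where g: "pcompose f [:b, 1:] = [:0, 1:] ^ m * g"
    by (auto simp: monom_altdef elim: dvdE)
  have "f = pcompose (pcompose f [:b, 1:]) [:- b, 1:]"
    by (simp add: pcompose_assoc[symmetric] pcompose_pCons)
  also have "\<dots> = [:- b, 1:] ^ m * pcompose g [:- b, 1:]"
    by (simp add: g pcompose_mult pcompose_power pcompose_pCons)
  finally show ?thesis by (metis dvd_triv_left)
qed

lemma sum_order_le_degree:
  fixes f :: "'a::idom poly"
  assumes "f \<noteq> 0" and "finite B"
  shows "(\<Sum>b\<in>B. order b f) \<le> degree f"
proof -
  have fin: "finite {x. poly f x = 0}"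
    using assms(1) by (rule poly_roots_finite)
  \<comment> \<open>Points that are not roots have order 0.\<close>
  have "(\<Sum>b\<in>B. order b f) = (\<Sum>b\<in>B \<inter> {x. poly f x = 0}. order b f)"
    using assms by (intro sum.mono_neutral_right) (auto simp: order_root)
  also have "\<dots> \<le> (\<Sum>b | poly f b = 0. order b f)"
    using fin by (intro sum_mono2) auto
  also have "\<dots> = size (proots f)"
    using assms(1) by (simp add: size_multiset_overloaded_eq)
  also have "\<dots> \<le> degree f"
    by (rule size_proots_le)
  finally show ?thesis .
qed

section \<open>Size bounds and the characteristic\<close>

lemma card_Z_le:
  assumes "d > 0"
  shows "card (Z d :: 'a::field set) \<le> d"
proof -
  let ?q = "monom 1 d - 1 :: 'a poly"
  have "coeff ?q d = 1"
    using assms by simp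
  then have "?q \<noteq> 0"
    by (metis coeff_0 zero_neq_one)
  have "Z d = {x. poly ?q x = 0}"
    by (auto simp: Z_def poly_monom)
  then have "card (Z d :: 'a set) \<le> degree ?q"
    using card_poly_roots_bound[OF \<open>?q \<noteq> 0\<close>] by simp
  also have "\<dots> \<le> d"
    by (intro degree_diff_le) (auto simp: degree_monom_le)
  finally show ?thesis .
qed

text \<open>The binomial coefficient divides \<open>fact m\<close>, which has no factor
  \<open>p\<close> since \<open>m < p\<close>.\<close>

lemma of_nat_binomial_neq_0:
  assumes "prime p" and "CHAR('a::semiring_1) = p" and "m < p" and "k \<le> m"
  shows "of_nat (m choose k) \<noteq> (0 :: 'a)"
proof -
  have "\<not> p dvd fact m"
    using assms(1,3) by (simp add: prime_dvd_fact_iff)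
  then have "\<not> p dvd m choose k"
    by (metis assms(4) binomial_fact_lemma dvd_mult)
  then show ?thesis
    using assms(2) by (simp add: of_nat_eq_0_iff_char_dvd)
qed

lemma CHAR_eq_CARD_if_prime:
  assumes "prime (CARD('a::{field,finite}))"
  shows "CHAR('a) = CARD('a)"
proof -
  \<comment> \<open>Translation by 1 permutes the field; cancelling the sum of all elements leaves
    \<open>CARD('a)\<close> copies of 1 adding up to 0.\<close>
  have "(\<Sum>x\<in>UNIV. x :: 'a) = (\<Sum>x\<in>UNIV. x + 1)"
    by (rule sum.reindex_bij_betw[symmetric]) (rule bij_plus_right)
  then have "of_nat (CARD('a)) = (0 :: 'a)"
    by (simp add: sum.distrib)
  then have "CHAR('a) dvd CARD('a)"
    by (simp only: of_nat_eq_0_iff_char_dvd)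
  then show ?thesis
    using assms CHAR_not_1'[where ?'a = 'a] by (auto simp: prime_nat_iff)
qed

text \<open>A single translate of \<open>A\<close> already has to fit into
  \<open>Z d \<union> {0}\<close>. The bound serves to keep \<open>card A - 1 + d\<close> below
  \<open>p\<close>.\<close>

lemma card_le_if_sumset_subset:
  fixes A B :: "'a::{field,finite} set"
  assumes "d > 0" and "A + B \<subseteq> Z d \<union> {0}" and "B \<noteq> {}"
  shows "card A \<le> d + 1"
proof -
  obtain b where b: "b \<in> B"
    using assms(3) by blast
  have "card A = card ((\<lambda>a. a + b) ` A)"
    by (simp add: card_image)
  also have "\<dots> \<le> card (Z d \<union> {0 :: 'a})"
    using assms(2) b by (intro card_mono) (auto intro: set_plus_intro)
  also have "\<dots> \<le> card (Z d :: 'a set) + 1"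
    using card_Un_le[of "Z d :: 'a set" "{0}"] by simp
  finally show ?thesis
    using card_Z_le[OF assms(1), where ?'a = 'a] by linarith
qed

section \<open>The auxiliary polynomial\<close>

definition stepanov_poly :: "'a::field set \<Rightarrow> nat \<Rightarrow> 'a poly" where
  "stepanov_poly A d = (\<Sum>a\<in>A. smult (lagrange_weight A a) ([:a, 1:] ^ (card A - 1 + d))) - 1"

lemma degree_stepanov_poly_le:
  assumes "finite A" and "A \<noteq> {}"
  shows "degree (stepanov_poly A d) \<le> d"
proof (rule degree_le, intro allI impI)
  fix j assume "d < j"
  let ?D = "card A - 1 + d"
  have "coeff (\<Sum>a\<in>A. smult (lagrange_weight A a) ([:a, 1:] ^ ?D)) j = 0"
  proof (cases "j \<le> ?D")
    case True
    \<comment> \<open>The coefficient of \<open>x ^ j\<close> is a multiple of the weighted moment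
      of order \<open>?D - j\<close>, and moments of order below \<open>card A - 1\<close>
      vanish.\<close>
    have "?D - j < card A - 1"
      using True \<open>d < j\<close> by linarith
    then have "(\<Sum>a\<in>A. lagrange_weight A a * a ^ (?D - j)) = 0"
      using sum_lagrange_weight_power[OF assms(1), of "?D - j" 0] by simp
    moreover have "coeff (\<Sum>a\<in>A. smult (lagrange_weight A a) ([:a, 1:] ^ ?D)) j
        = of_nat (?D choose j) * (\<Sum>a\<in>A. lagrange_weight A a * a ^ (?D - j))"
      using True by (simp add: coeff_sum coeff_linear_poly_power sum_distrib_left mult_ac)
    ultimately show ?thesis by simp
  next
    case False
    then show ?thesis
      by (auto simp: coeff_sum degree_power_eq intro!: sum.neutral coeff_eq_0)
  qed
  then show "coeff (stepanov_poly A d) j = 0"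
    using \<open>d < j\<close> by (simp add: stepanov_poly_def)
qed

lemma coeff_stepanov_poly:
  assumes "finite A" and "A \<noteq> {}" and "d > 0"
  shows "coeff (stepanov_poly A d) d = of_nat ((card A - 1 + d) choose d)"
proof -
  have "card A > 0"
    using assms by (simp add: card_gt_0_iff)
  then have "(\<Sum>a\<in>A. lagrange_weight A a * a ^ (card A - 1)) = 1"
    using sum_lagrange_weight_power[OF assms(1), of "card A - 1" 0] by simp
  moreover have "coeff (stepanov_poly A d) d
      = of_nat ((card A - 1 + d) choose d) * (\<Sum>a\<in>A. lagrange_weight A a * a ^ (card A - 1))"
    using assms(3)
    by (simp add: stepanov_poly_def coeff_sum coeff_linear_poly_power sum_distrib_left mult_ac)
  ultimately show ?thesis by simp
qed

text \<open>Once the extra exponent \<open>d\<close> is dropped, the coefficient contains the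
  weighted moment of order \<open>card A - 1 - k\<close>. It vanishes for \<open>k > 0\<close>; for
  \<open>k = 0\<close> it is 1 and cancels against the constant \<open>- 1\<close>.\<close>

lemma coeff_pcompose_stepanov_poly:
  assumes "finite A" and "k < card A"
    and "\<And>a. a \<in> A \<Longrightarrow> (a + b) ^ (card A - 1 - k + d) = (a + b) ^ (card A - 1 - k)"
  shows "coeff (pcompose (stepanov_poly A d) [:b, 1:]) k = 0"
proof -
  let ?n = "card A - 1" and ?w = "lagrange_weight A"
  have exponent: "?n + d - k = ?n - k + d"
    using assms(2) by linarith
  have "pcompose (stepanov_poly A d) [:b, 1:]
      = (\<Sum>a\<in>A. smult (?w a) ([:a + b, 1:] ^ (?n + d))) - 1"
    by (simp add: stepanov_poly_def pcompose_diff pcompose_sum pcompose_smult pcompose_1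
        pcompose_power pcompose_pCons)
  then have "coeff (pcompose (stepanov_poly A d) [:b, 1:]) k
      = of_nat ((?n + d) choose k) * (\<Sum>a\<in>A. ?w a * (a + b) ^ (?n - k + d)) - coeff 1 k"
    using assms(2) exponent
    by (simp add: coeff_sum coeff_linear_poly_power sum_distrib_left mult_ac)
  also have "(\<Sum>a\<in>A. ?w a * (a + b) ^ (?n - k + d)) = (\<Sum>a\<in>A. ?w a * (a + b) ^ (?n - k))"
    using assms(3) by (intro sum.cong) auto
  also have "\<dots> = of_bool (?n - k = ?n)"
    using assms(2) by (intro sum_lagrange_weight_power assms(1)) linarith
  also have "of_nat ((?n + d) choose k) * of_bool (?n - k = ?n) - coeff 1 k = (0 :: 'a)"
    using assms(2) by (cases "k = 0") auto
  finally show ?thesis .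
qed

theorem theorem1p2:
  fixes p d :: nat and A B :: "'a::{field,finite} set"
  assumes "prime p" and "CARD('a) = p"
    and "d > 0" and "d dvd p - 1" and "d \<noteq> p - 1"
    and "A + B \<subseteq> Z d \<union> {0}"
  shows "card A * card B \<le> d + card (B \<inter> uminus ` A)"
proof (cases "A = {} \<or> B = {}")
  case True
  then show ?thesis by auto
next
  case False
  let ?f = "stepanov_poly A d"
  have "p > 1"
    using assms(1) prime_gt_1_nat by blast
  have "2 * d \<le> p - 1"
  proof -
    obtain k where k: "p - 1 = d * k"
      using assms(4) by blast
    moreover have "p - 1 \<noteq> 0"
      using \<open>p > 1\<close> by linarith
    \<comment> \<open>The cofactor is at least 2 because the divisor \<open>d\<close> is
      proper.\<close>
    ultimately have "k \<noteq> 0" "k \<noteq> 1"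
      using assms(5) by (auto simp del: One_nat_def)
    then have "d * 2 \<le> d * k"
      by (intro mult_le_mono2) linarith
    then show ?thesis
      using k by linarith
  qed
  moreover have "card A \<le> d + 1"
    using card_le_if_sumset_subset assms(3,6) False by blast
  ultimately have "card A - 1 + d < p"
    using \<open>p > 1\<close> by linarith
  \<comment> \<open>The coefficient is a binomial coefficient whose upper entry is less than the
    characteristic.\<close>
  then have "coeff ?f d \<noteq> 0"
    using of_nat_binomial_neq_0[OF assms(1), where ?'a = 'a] CHAR_eq_CARD_if_prime[where ?'a = 'a]
      assms(1,2,3) False by (simp add: coeff_stepanov_poly)
  then have "?f \<noteq> 0"
    by auto
  have order_ge: "card A \<le> order b ?f + of_bool (b \<in> uminus ` A)" if "b \<in> B" for b
  proof -
    have "[:- b, 1:] ^ (card A - of_bool (b \<in> uminus ` A)) dvd ?f"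
    proof (intro linear_power_dvdI coeff_pcompose_stepanov_poly)
      fix k a assume k: "k < card A - of_bool (b \<in> uminus ` A)" and "a \<in> A"
      show "(a + b) ^ (card A - 1 - k + d) = (a + b) ^ (card A - 1 - k)"
      proof (cases "a + b = 0")
        case True
        then have "b \<in> uminus ` A"
          using \<open>a \<in> A\<close> by (metis image_eqI minus_unique)
        \<comment> \<open>This is where one order of vanishing is lost: for
          \<open>k = card A - 1\<close> the claim would read \<open>0 ^ d = 0 ^ 0\<close>, which is
          false since \<open>0 ^ 0 = 1\<close>.\<close>
        then have "card A - 1 - k > 0"
          using k by simp
        then show ?thesis
          using True by (simp add: power_0_left)
      next
        case False
        have "a + b \<in> Z d \<union> {0}"
          using assms(6) \<open>a \<in> A\<close> that by (blast intro: set_plus_intro)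
        then show ?thesis
          using False by (simp add: Z_def power_add)
      qed
    qed (simp_all add: less_diff_conv)
    then show ?thesis
      using \<open>?f \<noteq> 0\<close> by (simp add: order_divides)
  qed
  have "card A * card B = (\<Sum>b\<in>B. card A)"
    by simp
  also have "\<dots> \<le> (\<Sum>b\<in>B. order b ?f + of_bool (b \<in> uminus ` A))"
    by (intro sum_mono order_ge)
  also have "\<dots> = (\<Sum>b\<in>B. order b ?f) + card (B \<inter> uminus ` A)"
    by (simp add: sum.distrib Int_def)
  also have "\<dots> \<le> d + card (B \<inter> uminus ` A)"
    using sum_order_le_degree[OF \<open>?f \<noteq> 0\<close>, of B] degree_stepanov_poly_le[of A d] False by simp
  finally show ?thesis .
qed

end
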